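(* For every integer $n\ge 1$, the dicyclic group $Q_{4n}=\langle a,b \mid a^{2n}=1,\ a^n b^2=1,\ abab^{-1}=1\rangle$ of order $4n$ is a t-group.
   Context: All groups are finite. Let $G$ be a finite group and $H\le G$. A normalized right transversal (NRT) of $H$ in $G$ is a subset $S\subseteq G$ containing exactly one element from each right coset of $H$ in $G$ and with $1\in S$. $\mathcal{T}(G,H)$ denotes the set of all NRTs of $H$ in $G$. Each NRT $S$ carries the binary operation $\circ$ defined by $\{x\circ y\}=S\cap Hxy$, which makes $S$ a right loop with identity $1$. Two NRTs (possibly of different subgroups) are isomorphic, written $S_1\cong S_2$, if there is a bijection between them preserving these operations. For a divisor $d$ of $|G|$, the transiso graph $\Gamma_d(G)$ is the simple graph whose vertices are the subgroups of $G$ of order $d$, two distinct vertices $H_1,H_2$ being adjacent if and only if there exist $S_1\in\mathcal{T}(G,H_1)$ and $S_2\in\mathcal{T}(G,H_2)$ with $S_1\cong S_2$. A graph is complete if any two distinct vertices are adjacent (so graphs with at most one vertex are complete). A finite group $G$ is a t-group if $\Gamma_d(G)$ is complete for every divisor $d$ of $|G|$. *)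

theory Defs
  imports "HOL-Algebra.Coset"
begin

section \<open>Normalized right transversals\<close>

definition nrt :: "('a, 'm) monoid_scheme \<Rightarrow> 'a set \<Rightarrow> 'a set set" where
  "nrt G H = {S. S \<subseteq> carrier G \<and> \<one>\<^bsub>G\<^esub> \<in> S \<and> (\<forall>C \<in> rcosets\<^bsub>G\<^esub> H. \<exists>!x. x \<in> S \<inter> C)}"

text \<open>The right loop on \<open>S\<close> is packaged as a monoid record so that \<open>\<cong>\<close> of HOL-Algebra
  applies; \<open>\<circ>\<close> need not be associative. \<open>\<cong>\<close> only asks for a bijection of the carriers
  preserving the operation.\<close>

definition nrt_loop :: "('a, 'm) monoid_scheme \<Rightarrow> 'a set \<Rightarrow> 'a set \<Rightarrow> 'a monoid" where
  "nrt_loop G H S =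
    \<lparr>carrier = S, mult = (\<lambda>x y. THE z. z \<in> S \<inter> (H #>\<^bsub>G\<^esub> (x \<otimes>\<^bsub>G\<^esub> y))), one = \<one>\<^bsub>G\<^esub>\<rparr>"


section \<open>Transiso graphs and t-groups\<close>

text \<open>A simple graph is a pair of a vertex set and a set of two-element sets of vertices.\<close>

definition complete_graph :: "'v set \<times> 'v set set \<Rightarrow> bool" where
  "complete_graph \<Gamma> \<longleftrightarrow> (\<forall>u \<in> fst \<Gamma>. \<forall>v \<in> fst \<Gamma>. u \<noteq> v \<longrightarrow> {u, v} \<in> snd \<Gamma>)"

definition transiso_graph ::
    "('a, 'm) monoid_scheme \<Rightarrow> nat \<Rightarrow> 'a set set \<times> 'a set set set" where
  "transiso_graph G d =
    ({H. subgroup H G \<and> card H = d},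
     {{H1, H2} | H1 H2.
        subgroup H1 G \<and> card H1 = d \<and> subgroup H2 G \<and> card H2 = d \<and> H1 \<noteq> H2 \<and>
        (\<exists>S1 \<in> nrt G H1. \<exists>S2 \<in> nrt G H2. nrt_loop G H1 S1 \<cong> nrt_loop G H2 S2)})"

definition t_group :: "('a, 'm) monoid_scheme \<Rightarrow> bool" where
  "t_group G \<longleftrightarrow> group G \<and> finite (carrier G) \<and>
    (\<forall>d. d dvd order G \<longrightarrow> complete_graph (transiso_graph G d))"


section \<open>Groups given by generators and relators\<close>

text \<open>The group presented by a set \<open>R\<close> of relators, the generators being all elements of the
  type \<open>'g\<close>: words in the generators and their formal inverses, modulo the congruence that
  cancels adjacent inverse letters and erases relators.\<close>

datatype 'g letter = Gen 'g | Gen_inv 'g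

inductive word_eq :: "'g letter list set \<Rightarrow> 'g letter list \<Rightarrow> 'g letter list \<Rightarrow> bool"
  for R where
  refl: "word_eq R w w"
| sym: "word_eq R v w \<Longrightarrow> word_eq R w v"
| trans: "word_eq R u v \<Longrightarrow> word_eq R v w \<Longrightarrow> word_eq R u w"
| cancel_right: "word_eq R (u @ [Gen x, Gen_inv x] @ v) (u @ v)"
| cancel_left: "word_eq R (u @ [Gen_inv x, Gen x] @ v) (u @ v)"
| relator: "r \<in> R \<Longrightarrow> word_eq R (u @ r @ v) (u @ v)"

definition word_class :: "'g letter list set \<Rightarrow> 'g letter list \<Rightarrow> 'g letter list set" where
  "word_class R w = {v. word_eq R w v}"

definition presented_group :: "'g letter list set \<Rightarrow> 'g letter list set monoid" where
  "presented_group R =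
    \<lparr>carrier = range (word_class R),
     mult = (\<lambda>X Y. \<Union>u \<in> X. \<Union>v \<in> Y. word_class R (u @ v)),
     one = word_class R []\<rparr>"

lemma word_class_eq_iff: "word_class R u = word_class R v \<longleftrightarrow> word_eq R u v"
proof
  assume "word_class R u = word_class R v"
  then have "v \<in> word_class R u"
    by (simp add: word_class_def word_eq.refl)
  then show "word_eq R u v"
    by (simp add: word_class_def)
next
  assume uv: "word_eq R u v"
  have "word_eq R u w \<longleftrightarrow> word_eq R v w" for w
    using word_eq.trans[OF uv] word_eq.trans[OF word_eq.sym[OF uv]] by blast
  then show "word_class R u = word_class R v"
    by (simp add: word_class_def)
qed

lemma word_eq_append_left: "word_eq R u v \<Longrightarrow> word_eq R (w @ u) (w @ v)"
proof (induction rule: word_eq.induct)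
  case (cancel_right u x v)
  show ?case using word_eq.cancel_right[of R "w @ u" x v] by simp
next
  case (cancel_left u x v)
  show ?case using word_eq.cancel_left[of R "w @ u" x v] by simp
next
  case (relator r u v)
  then show ?case using word_eq.relator[of r R "w @ u" v] by simp
qed (fact word_eq.refl, erule word_eq.sym, erule (1) word_eq.trans)

lemma word_eq_append_right: "word_eq R u v \<Longrightarrow> word_eq R (u @ w) (v @ w)"
proof (induction rule: word_eq.induct)
  case (cancel_right u x v)
  show ?case using word_eq.cancel_right[of R u x "v @ w"] by simp
next
  case (cancel_left u x v)
  show ?case using word_eq.cancel_left[of R u x "v @ w"] by simp
next
  case (relator r u v)
  then show ?case using word_eq.relator[of r R u "v @ w"] by simp
qed (fact word_eq.refl, erule word_eq.sym, erule (1) word_eq.trans)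

lemma word_eq_append:
  "word_eq R u u' \<Longrightarrow> word_eq R v v' \<Longrightarrow> word_eq R (u @ v) (u' @ v')"
  by (rule word_eq.trans[OF word_eq_append_right word_eq_append_left])

lemma presented_group_mult:
  "word_class R u \<otimes>\<^bsub>presented_group R\<^esub> word_class R v = word_class R (u @ v)"
proof -
  have "word_class R (u' @ v') = word_class R (u @ v)"
    if "u' \<in> word_class R u" "v' \<in> word_class R v" for u' v'
    unfolding word_class_eq_iff using that
    by (intro word_eq.sym[OF word_eq_append]) (simp_all add: word_class_def)
  then have "(\<Union>u' \<in> word_class R u. \<Union>v' \<in> word_class R v. word_class R (u' @ v'))
      = (\<Union>u' \<in> word_class R u. \<Union>v' \<in> word_class R v. word_class R (u @ v))"
    by (simp cong: SUP_cong_simp)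
  moreover have "word_class R u \<noteq> {}" "word_class R v \<noteq> {}"
    by (auto simp: word_class_def intro: word_eq.refl)
  ultimately show ?thesis
    by (simp add: presented_group_def)
qed

fun inv_letter :: "'g letter \<Rightarrow> 'g letter" where
  "inv_letter (Gen x) = Gen_inv x"
| "inv_letter (Gen_inv x) = Gen x"

lemma word_eq_inverse: "word_eq R (rev (map inv_letter w) @ w) []"
proof (induction w)
  case Nil
  show ?case by (simp add: word_eq.refl)
next
  case (Cons l w)
  have "word_eq R (rev (map inv_letter w) @ [inv_letter l, l] @ w)
          (rev (map inv_letter w) @ w)"
    by (cases l) (simp_all only: inv_letter.simps word_eq.cancel_left word_eq.cancel_right)
  from word_eq.trans[OF this Cons] show ?case by simp
qed

lemma group_presented_group: "group (presented_group R)"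
proof -
  have carr: "carrier (presented_group R) = range (word_class R)"
    and one: "\<one>\<^bsub>presented_group R\<^esub> = word_class R []"
    by (simp_all add: presented_group_def)
  show ?thesis
  proof (rule groupI)
    fix X assume "X \<in> carrier (presented_group R)"
    then obtain w where X: "X = word_class R w" by (auto simp: carr)
    have "word_class R (rev (map inv_letter w)) \<otimes>\<^bsub>presented_group R\<^esub> X
        = \<one>\<^bsub>presented_group R\<^esub>"
      unfolding X one presented_group_mult word_class_eq_iff by (rule word_eq_inverse)
    then show "\<exists>Y \<in> carrier (presented_group R). Y \<otimes>\<^bsub>presented_group R\<^esub> X
        = \<one>\<^bsub>presented_group R\<^esub>"
      unfolding carr by blast
  qed (auto simp: carr one presented_group_mult)
qed


section \<open>Dicyclic groups\<close>

datatype dicyclic_gen = A | B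

definition dicyclic_relators :: "nat \<Rightarrow> dicyclic_gen letter list set" where
  "dicyclic_relators n =
    {replicate (2 * n) (Gen A),
     replicate n (Gen A) @ [Gen B, Gen B],
     [Gen A, Gen B, Gen A, Gen_inv B]}"

definition dicyclic_group :: "nat \<Rightarrow> dicyclic_gen letter list set monoid" where
  "dicyclic_group n = presented_group (dicyclic_relators n)"

end

theory Submission
  imports Defs
begin

text \<open>A subgroup of \<open>Q\<^bsub>4n\<^esub>\<close> is either \<open>\<langle>a\<^sup>k\<rangle>\<close> or \<open>\<langle>a\<^sup>k, a\<^sup>c b\<rangle>\<close> with \<open>k\<close> dividing \<open>n\<close>. If a transversal
  \<open>S\<close> of \<open>H\<close> lies in a subgroup \<open>K\<close> such that \<open>H \<inter> K\<close> is normal in \<open>K\<close>, then its loop is the group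
  \<open>K / (H \<inter> K)\<close>. For two subgroups \<open>\<langle>a\<^sup>k, a\<^sup>c b\<rangle>\<close> of the same order, \<open>K = \<langle>a\<rangle>\<close> gives the cyclic group of
  order \<open>k\<close> for both. The subgroup \<open>\<langle>a\<^bsup>2m\<^esup>, a\<^sup>c b\<rangle>\<close> has the same order as \<open>\<langle>a\<^sup>m\<rangle>\<close>; here
  \<open>K = \<langle>a\<^sup>2, a\<^bsup>c + 1\<^esup> b\<rangle>\<close> gives a dihedral group isomorphic to \<open>Q\<^bsub>4n\<^esub> / \<langle>a\<^sup>m\<rangle>\<close>.\<close>


section \<open>Transversals given by indexed families\<close>

context group
begin

lemma mem_r_coset_iff:
  assumes "subgroup H G" "x \<in> carrier G" "g \<in> carrier G"
  shows "x \<in> H #> g \<longleftrightarrow> x \<otimes> inv g \<in> H"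
proof
  assume "x \<in> H #> g"
  then obtain h where "h \<in> H" "x = h \<otimes> g" by (auto simp: r_coset_def)
  with assms show "x \<otimes> inv g \<in> H"
    by (simp add: m_assoc subgroup.mem_carrier)
next
  assume "x \<otimes> inv g \<in> H"
  moreover have "x = (x \<otimes> inv g) \<otimes> g" using assms by (simp add: m_assoc)
  ultimately show "x \<in> H #> g" unfolding r_coset_def by blast
qed

text \<open>Indexing by a common set \<open>J\<close> lets transversals of different subgroups be
  matched index by index. Injectivity comes from applying \<open>ex1\<close> to the coset of
  \<open>p j\<close> itself.\<close>

lemma nrt_family:
  assumes H: "subgroup H G" and p: "p ` J \<subseteq> carrier G" "\<one> \<in> p ` J"
    and ex1: "\<And>g. g \<in> carrier G \<Longrightarrow> \<exists>!j. j \<in> J \<and> p j \<in> H #> g"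
  shows "p ` J \<in> nrt G H" "inj_on p J"
proof -
  show "p ` J \<in> nrt G H"
    unfolding nrt_def
  proof (intro CollectI conjI ballI)
    fix C assume "C \<in> rcosets H"
    then obtain g where g: "g \<in> carrier G" "C = H #> g" by (auto simp: RCOSETS_def)
    with ex1[OF g(1)] show "\<exists>!x. x \<in> p ` J \<inter> C" by blast
  qed (use p in auto)
  show "inj_on p J"
  proof (rule inj_onI)
    fix i j assume ij: "i \<in> J" "j \<in> J" "p i = p j"
    then have c: "p j \<in> carrier G" using p by auto
    then have "p j \<in> H #> p j" by (simp add: rcos_self H)
    with ex1[OF c] ij show "i = j" by metis
  qed
qed

lemma nrt_mult:
  assumes H: "subgroup H G" and S: "S \<in> nrt G H" and xy: "x \<in> S" "y \<in> S"
  shows "x \<otimes>\<^bsub>nrt_loop G H S\<^esub> y \<in> S"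
    and "x \<otimes>\<^bsub>nrt_loop G H S\<^esub> y \<in> H #> (x \<otimes> y)"
    and "\<And>z. z \<in> S \<Longrightarrow> z \<in> H #> (x \<otimes> y) \<Longrightarrow> x \<otimes>\<^bsub>nrt_loop G H S\<^esub> y = z"
proof -
  have "x \<otimes> y \<in> carrier G" using S xy by (auto simp: nrt_def)
  then have "H #> (x \<otimes> y) \<in> rcosets H" by (simp add: rcosetsI subgroup.subset[OF H])
  then have ex1: "\<exists>!z. z \<in> S \<inter> (H #> (x \<otimes> y))" using S by (auto simp: nrt_def)
  from theI'[OF this]
  show "x \<otimes>\<^bsub>nrt_loop G H S\<^esub> y \<in> S" "x \<otimes>\<^bsub>nrt_loop G H S\<^esub> y \<in> H #> (x \<otimes> y)"
    by (auto simp: nrt_loop_def)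
  show "x \<otimes>\<^bsub>nrt_loop G H S\<^esub> y = z" if "z \<in> S" "z \<in> H #> (x \<otimes> y)" for z
    using the1_equality[OF ex1, of z] that by (simp add: nrt_loop_def)
qed

text \<open>The isomorphism sends \<open>p j\<close> to \<open>q j\<close>. Transfer in one
  direction suffices: the loop product of \<open>p i\<close> and \<open>p j\<close> is some
  \<open>p l\<close>, and \<open>q l\<close> is then the only element of the second transversal in
  the coset of \<open>q i \<otimes> q j\<close>.\<close>

lemma nrt_loop_iso:
  assumes H: "subgroup H G" and K: "subgroup K G"
    and p: "p ` J \<in> nrt G H" "inj_on p J" and q: "q ` J \<in> nrt G K" "inj_on q J"
    and transfer: "\<And>i j l. \<lbrakk>i \<in> J; j \<in> J; l \<in> J; p l \<in> H #> (p i \<otimes> p j)\<rbrakk>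
      \<Longrightarrow> q l \<in> K #> (q i \<otimes> q j)"
  shows "nrt_loop G H (p ` J) \<cong> nrt_loop G K (q ` J)"
proof -
  let ?L = "nrt_loop G H (p ` J)" and ?M = "nrt_loop G K (q ` J)"
  define f where "f = (\<lambda>x. q (the_inv_into J p x))"
  have f: "f (p j) = q j" if "j \<in> J" for j
    using that p(2) by (simp add: f_def the_inv_into_f_f)
  have "bij_betw f (p ` J) (q ` J)"
  proof (rule bij_betw_imageI)
    show "inj_on f (p ` J)" using q(2) by (auto intro!: inj_onI simp: f dest: inj_onD)
    show "f ` p ` J = q ` J" by (auto simp: image_image f)
  qed
  moreover have "f (x \<otimes>\<^bsub>?L\<^esub> y) = f x \<otimes>\<^bsub>?M\<^esub> f y" if xy: "x \<in> p ` J" "y \<in> p ` J" for x y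
  proof -
    obtain i j where ij: "i \<in> J" "j \<in> J" "x = p i" "y = p j" using xy by auto
    obtain l where l: "l \<in> J" "x \<otimes>\<^bsub>?L\<^esub> y = p l" using nrt_mult(1)[OF H p(1) xy] by auto
    have "q l \<in> K #> (q i \<otimes> q j)"
      using nrt_mult(2)[OF H p(1) xy] transfer[OF ij(1,2) l(1)] ij l by simp
    then have "q i \<otimes>\<^bsub>?M\<^esub> q j = q l"
      using nrt_mult(3)[OF K q(1), of "q i" "q j" "q l"] ij l by simp
    then show ?thesis using ij l by (simp add: f)
  qed
  ultimately have "f \<in> iso ?L ?M"
    using nrt_mult(1)[OF H p(1)]
    by (auto simp: iso_def hom_def bij_betw_def nrt_loop_def image_image f)
  then show ?thesis by (auto simp: is_iso_def)
qed

end


section \<open>Groups with the multiplication table of a dicyclic group\<close>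

text \<open>The generator is the least positive member: the remainder of any member modulo it is
  again a member, hence zero. This is meant for the exponents of the powers of \<open>a\<close>
  lying in a subgroup.\<close>

lemma int_subgroup_eq_multiples:
  fixes I :: "int set"
  assumes diff: "\<And>i j. i \<in> I \<Longrightarrow> j \<in> I \<Longrightarrow> i - j \<in> I" and m: "m \<in> I" "m > 0"
  obtains k where "k > 0" "I = {i. k dvd i}"
proof -
  define k where "k = int (LEAST k. k > 0 \<and> int k \<in> I)"
  have "nat m > 0 \<and> int (nat m) \<in> I" using m by simp
  from LeastI[of "\<lambda>k. k > 0 \<and> int k \<in> I", OF this]
  have k: "k > 0" "k \<in> I" by (auto simp: k_def)
  have least: "k \<le> i" if "i > 0" "i \<in> I" for i
    using Least_le[of "\<lambda>k. k > 0 \<and> int k \<in> I" "nat i"] that by (simp add: k_def)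
  have zero: "0 \<in> I" using diff[OF k(2) k(2)] by simp
  have add: "i + j \<in> I" if "i \<in> I" "j \<in> I" for i j
    using diff[OF that(1) diff[OF zero that(2)]] by simp
  have mult: "k * q \<in> I" for q
  proof (induction q rule: int_induct[of _ 0])
    case (step1 q)
    then show ?case using add[OF _ k(2)] by (simp add: distrib_left)
  next
    case (step2 q)
    then show ?case using diff[OF _ k(2)] by (simp add: right_diff_distrib)
  qed (simp add: zero)
  have "k dvd i" if "i \<in> I" for i
  proof (rule ccontr)
    assume "\<not> k dvd i"
    then have "i mod k > 0" using k(1) by (simp add: dvd_eq_mod_eq_0 order_less_le)
    moreover have "i mod k \<in> I"
      using diff[OF that mult[of "i div k"]] by (simp add: minus_mult_div_eq_mod)
    ultimately show False using least[of "i mod k"] pos_mod_bound[OF k(1), of i] by simp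
  qed
  then have "I = {i. k dvd i}" using mult by auto
  with k(1) that show thesis by blast
qed

lemma ex1_residue:
  fixes g k :: int
  assumes "k > 0"
  shows "\<exists>!t. t \<in> {0..<k} \<and> k dvd t - g"
proof (rule ex1I[of _ "g mod k"])
  show "g mod k \<in> {0..<k} \<and> k dvd g mod k - g"
    using assms by (simp add: mod_eq_dvd_iff[symmetric])
next
  fix t assume t: "t \<in> {0..<k} \<and> k dvd t - g"
  then have "t mod k = g mod k" by (subst mod_eq_dvd_iff) simp
  moreover have "t mod k = t" using t by simp
  ultimately show "t = g mod k" by simp
qed

text \<open>For transversals indexed by pairs: a coset forces the Boolean, so only the residue
  remains to be determined.\<close>

lemma ex1_Pair:
  assumes "\<exists>!t. P t" and "\<And>u t. Q (u, t) \<longleftrightarrow> u = s \<and> P t"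
  shows "\<exists>!j. Q j"
proof -
  from assms(1) obtain t where t: "P t" "\<forall>v. P v \<longrightarrow> v = t" by (rule ex1E)
  show ?thesis
  proof (rule ex1I[of _ "(s, t)"])
    show "Q (s, t)" using t(1) by (simp add: assms(2))
    show "j = (s, t)" if "Q j" for j
      using that t(2) by (cases j) (simp add: assms(2))
  qed
qed

text \<open>The parity of \<open>e\<close> decides which branch is even, and the even branch is
  twice the difference of \<open>t\<close> and a fixed integer. This finds the index that represents
  a given coset of \<open>dic (2 * m) c\<close>.\<close>

lemma double_dvd_iff:
  fixes e m t :: int
  shows "2 * m dvd (if u then 2 * t + 1 + e else 2 * t - e) \<longleftrightarrow>
    u = odd e \<and> m dvd t - (if odd e then - ((e + 1) div 2) else e div 2)"
proof -
  define z where "z = (if u then 2 * t + 1 + e else 2 * t - e)"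
  define h where "h = (if odd e then - ((e + 1) div 2) else e div 2)"
  have "2 * m dvd z \<longleftrightarrow> u = odd e \<and> m dvd t - h"
  proof (cases "u = odd e")
    case True
    then have "z = 2 * (t - h)"
      by (cases u) (simp_all add: z_def h_def, presburger+)
    then have "2 * m dvd z \<longleftrightarrow> m dvd t - h"
      by (simp only: dvd_times_left_cancel_iff[of 2 m "t - h"])
    with True show ?thesis by simp
  next
    case False
    then have "odd z" by (cases u) (simp_all add: z_def)
    then have "\<not> 2 * m dvd z" by (metis dvd_mult_left)
    with False show ?thesis by simp
  qed
  then show ?thesis unfolding z_def h_def .
qed

text \<open>In a dicyclic group, \<open>r i\<close> is \<open>a\<^sup>i\<close> and \<open>y i\<close> is \<open>a\<^sup>i b\<close>.\<close>

locale dicyclic = group G for G (structure) +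
  fixes n :: int and r y :: "int \<Rightarrow> 'a"
  assumes n_pos: "n > 0"
    and carrier_eq: "carrier G = range r \<union> range y"
    and rr: "r i \<otimes> r j = r (i + j)"
    and ry: "r i \<otimes> y j = y (i + j)"
    and yr: "y i \<otimes> r j = y (i - j)"
    and yy: "y i \<otimes> y j = r (i - j + n)"
    and r_eq_iff: "r i = r j \<longleftrightarrow> 2 * n dvd i - j"
    and y_eq_iff: "y i = y j \<longleftrightarrow> 2 * n dvd i - j"
    and r_neq_y: "r i \<noteq> y j"
begin

lemma r_closed [simp]: "r i \<in> carrier G" and y_closed [simp]: "y i \<in> carrier G"
  by (auto simp: carrier_eq)

lemma one_eq: "\<one> = r 0"
  using rr[of 0 0] by (simp add: r_cancel_one')

lemma inv_r: "inv (r i) = r (- i)"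
  by (rule inv_equality) (simp_all add: rr one_eq)

lemma inv_y: "inv (y i) = y (i + n)"
  by (rule inv_equality) (simp_all add: yy one_eq r_eq_iff)

lemma r_mod: "r (i mod (2 * n)) = r i" and y_mod: "y (i mod (2 * n)) = y i"
  by (simp_all add: r_eq_iff y_eq_iff mod_eq_dvd_iff [symmetric])

lemma carrier_eq_finite: "carrier G = r ` {0..<2 * n} \<union> y ` {0..<2 * n}"
proof -
  have "i mod (2 * n) \<in> {0..<2 * n}" for i using n_pos by simp
  then have "r i \<in> r ` {0..<2 * n}" "y i \<in> y ` {0..<2 * n}" for i
    by (metis r_mod imageI, metis y_mod imageI)
  then show ?thesis by (auto simp: carrier_eq)
qed

lemma finite_carrier: "finite (carrier G)"
  unfolding carrier_eq_finite by simp

section \<open>Subgroups and their orders\<close>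

definition rot :: "int \<Rightarrow> 'a set" where
  "rot k = r ` {i. k dvd i}"

text \<open>For \<open>k\<close> dividing \<open>n\<close> this is the subgroup generated by
  \<open>a^k\<close> and \<open>a^c b\<close>; for other \<open>k\<close> it need not be closed,
  since \<open>a^c b\<close> has square \<open>a^n\<close>.\<close>

definition dic :: "int \<Rightarrow> int \<Rightarrow> 'a set" where
  "dic k c = rot k \<union> y ` {i. k dvd i - c}"

text \<open>An exponent is determined only modulo \<open>2 * n\<close>; since \<open>k\<close>
  divides \<open>2 * n\<close>, divisibility by \<open>k\<close> does not depend on the exponent
  chosen.\<close>

lemma r_mem_rot:
  assumes "k dvd 2 * n"
  shows "r i \<in> rot k \<longleftrightarrow> k dvd i"
proof -
  have "k dvd i" if "2 * n dvd i - j" "k dvd j" for j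
    using dvd_add[OF dvd_trans[OF assms that(1)] that(2)] by simp
  then show ?thesis by (auto simp: rot_def r_eq_iff)
qed

lemma y_mem_rot: "y i \<notin> rot k"
  by (auto simp: rot_def r_neq_y[symmetric])

lemma r_mem_dic: "k dvd 2 * n \<Longrightarrow> r i \<in> dic k c \<longleftrightarrow> k dvd i"
  by (auto simp: dic_def r_mem_rot r_neq_y)

lemma y_mem_dic:
  assumes "k dvd 2 * n"
  shows "y i \<in> dic k c \<longleftrightarrow> k dvd i - c"
proof -
  have "k dvd i - c" if "2 * n dvd i - j" "k dvd j - c" for j
    using dvd_add[OF dvd_trans[OF assms that(1)] that(2)] by simp
  then show ?thesis by (auto simp: dic_def y_mem_rot y_eq_iff)
qed

text \<open>If \<open>2 * n = k * m\<close>, the elements \<open>r (k * t)\<close> with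
  \<open>0 \<le> t < m\<close> list \<open>rot k\<close> without repetition.\<close>

lemma card_rot:
  assumes "k > 0" "k dvd 2 * n"
  shows "int (card (rot k)) * k = 2 * n"
proof -
  obtain m where m: "2 * n = k * m" using assms(2) by blast
  have "m > 0" using m assms(1) n_pos by (smt (verit) zero_less_mult_iff)
  have inj: "inj_on (\<lambda>t. r (k * t)) {0..<m}"
  proof (rule inj_onI)
    fix s t assume st: "s \<in> {0..<m}" "t \<in> {0..<m}" "r (k * s) = r (k * t)"
    then have "k * m dvd k * (s - t)" by (simp add: r_eq_iff m right_diff_distrib)
    then have "m dvd s - t" using assms(1) by simp
    then have "s mod m = t mod m" by (simp add: mod_eq_dvd_iff)
    with st show "s = t" by simp
  qed
  have "rot k = (\<lambda>t. r (k * t)) ` {0..<m}"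
  proof
    show "rot k \<subseteq> (\<lambda>t. r (k * t)) ` {0..<m}"
    proof
      fix x assume "x \<in> rot k"
      then obtain i where i: "x = r i" "k dvd i" unfolding rot_def by blast
      from i(2) obtain t where "i = k * t" by (rule dvdE)
      with i(1) have t: "x = r (k * t)" by simp
      have "k * (t mod m) = (k * t) mod (2 * n)" unfolding m by (rule mult_mod_right)
      then have "x = r (k * (t mod m))" by (simp add: t r_mod)
      moreover have "t mod m \<in> {0..<m}" using \<open>m > 0\<close> by simp
      ultimately show "x \<in> (\<lambda>t. r (k * t)) ` {0..<m}" by blast
    qed
  qed (auto simp: rot_def)
  then have "int (card (rot k)) = m" using card_image[OF inj] \<open>m > 0\<close> by simp
  then show ?thesis by (simp add: m)
qed

text \<open>The elements outside \<open>rot k\<close> form its right translate by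
  \<open>y c\<close>, so the order doubles.\<close>

lemma card_dic:
  assumes "k > 0" "k dvd 2 * n"
  shows "int (card (dic k c)) * k = 4 * n"
proof -
  let ?Y = "y ` {i. k dvd i - c}"
  have "?Y = (\<lambda>x. x \<otimes> y c) ` rot k"
  proof -
    have "{i. k dvd i - c} = (\<lambda>i. i + c) ` {i. k dvd i}"
      by (auto intro!: image_eqI[of _ _ "_ - c"])
    then show ?thesis by (simp add: rot_def image_image ry)
  qed
  moreover have "inj_on (\<lambda>x. x \<otimes> y c) (rot k)"
    by (rule inj_onI) (auto simp: rot_def)
  ultimately have "card ?Y = card (rot k)" by (simp add: card_image)
  moreover have "finite (rot k)" "finite ?Y"
    by (auto intro!: finite_subset[OF _ finite_carrier] simp: rot_def)
  moreover have "rot k \<inter> ?Y = {}" by (auto simp: y_mem_rot)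
  ultimately have "card (dic k c) = 2 * card (rot k)"
    by (simp add: dic_def card_Un_disjoint)
  with card_rot[OF assms] show ?thesis by (simp add: mult.commute)
qed

text \<open>The exponents of the powers of \<open>a\<close> in \<open>H\<close> form a subgroup of
  the integers containing \<open>2 * n\<close>, which gives \<open>k\<close>. One element
  \<open>y c\<close> then fixes all others, because the quotient of \<open>y i\<close> by
  \<open>y c\<close> is \<open>r (i - c)\<close>.\<close>

lemma subgroup_cases:
  assumes H: "subgroup H G"
  obtains (rot) k where "k > 0" "k dvd 2 * n" "H = rot k"
    | (dic) k c where "k > 0" "k dvd n" "H = dic k c"
proof -
  let ?I = "{i. r i \<in> H}"
  have diff: "i - j \<in> ?I" if "i \<in> ?I" "j \<in> ?I" for i j
    using subgroup.m_closed[OF H, of "r i" "inv (r j)"] subgroup.m_inv_closed[OF H, of "r j"] that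
    by (simp add: inv_r rr)
  have "r (2 * n) = \<one>" by (simp add: one_eq r_eq_iff)
  then have "2 * n \<in> ?I" using subgroup.one_closed[OF H] by simp
  with diff obtain k where k: "k > 0" "?I = {i. k dvd i}"
    by (rule int_subgroup_eq_multiples) (use n_pos in auto)
  have rH: "r i \<in> H \<longleftrightarrow> k dvd i" for i using k(2) by blast
  have k2n: "k dvd 2 * n" using \<open>2 * n \<in> ?I\<close> rH by blast
  have sub: "H \<subseteq> range r \<union> range y" using subgroup.subset[OF H] carrier_eq by simp
  show thesis
  proof (cases "\<exists>c. y c \<in> H")
    case False
    then have "H = rot k" using sub by (auto simp: rH rot_def)
    with k(1) k2n show thesis by (rule that(1))
  next
    case True
    then obtain c where c: "y c \<in> H" by blast
    \<comment> \<open>The square of \<open>a^c b\<close> is \<open>a^n\<close>, so here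
      \<open>k\<close> divides \<open>n\<close> and not merely \<open>2 * n\<close>.\<close>
    have "r n \<in> H" using subgroup.m_closed[OF H c c] by (simp add: yy)
    then have kn: "k dvd n" by (simp add: rH)
    have yH: "y i \<in> H \<longleftrightarrow> k dvd i - c" for i
    proof
      assume "y i \<in> H"
      then have "y i \<otimes> inv (y c) \<in> H"
        using subgroup.m_closed[OF H] subgroup.m_inv_closed[OF H c] by blast
      then show "k dvd i - c" by (simp add: inv_y yy rH)
    next
      assume "k dvd i - c"
      then have "r (i - c) \<in> H" by (simp add: rH)
      from subgroup.m_closed[OF H this c] show "y i \<in> H" by (simp add: ry)
    qed
    have "H = dic k c" using sub by (auto simp: rH yH rot_def dic_def)
    with k(1) kn show thesis by (rule that(2))
  qed
qed

section \<open>Cosets and isomorphic transversals\<close>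

text \<open>Each case tests the quotient of the two elements. The summand \<open>n\<close> from
  inverting \<open>y j\<close> disappears because \<open>k\<close> divides \<open>n\<close>.\<close>

lemma mem_coset_dic:
  assumes "subgroup (dic k c) G" "k dvd n"
  shows "r i \<in> dic k c #> r j \<longleftrightarrow> k dvd i - j"
    and "r i \<in> dic k c #> y j \<longleftrightarrow> k dvd i - (c - j)"
    and "y i \<in> dic k c #> r j \<longleftrightarrow> k dvd i - (c - j)"
    and "y i \<in> dic k c #> y j \<longleftrightarrow> k dvd i - j"
proof -
  have k: "k dvd 2 * n" using assms(2) by simp
  have "k dvd i + (j + n) - c \<longleftrightarrow> k dvd i - (c - j)"
    using dvd_add_left_iff[OF assms(2), of "i - (c - j)"] by (simp add: algebra_simps)
  then show "r i \<in> dic k c #> r j \<longleftrightarrow> k dvd i - j"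
    "r i \<in> dic k c #> y j \<longleftrightarrow> k dvd i - (c - j)"
    "y i \<in> dic k c #> r j \<longleftrightarrow> k dvd i - (c - j)"
    "y i \<in> dic k c #> y j \<longleftrightarrow> k dvd i - j"
    by (simp_all add: mem_r_coset_iff[OF assms(1)] inv_r inv_y rr ry yr yy
        r_mem_dic[OF k] y_mem_dic[OF k] algebra_simps)
qed

lemma mem_coset_rot:
  assumes "subgroup (rot k) G" "k dvd 2 * n"
  shows "r i \<in> rot k #> r j \<longleftrightarrow> k dvd i - j"
    and "r i \<notin> rot k #> y j"
    and "y i \<notin> rot k #> r j"
    and "y i \<in> rot k #> y j \<longleftrightarrow> k dvd i - j"
  by (simp_all add: mem_r_coset_iff[OF assms(1)] inv_r inv_y rr ry yr yy
      r_mem_rot[OF assms(2)] y_mem_rot)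

text \<open>Among powers of \<open>a\<close> the coset condition does not involve \<open>c\<close>,
  so one set of powers is a transversal of both subgroups, with the same products.\<close>

lemma dic_dic_iso:
  assumes c: "subgroup (dic k c) G" and d: "subgroup (dic k d) G" and k: "k > 0" "k dvd n"
  shows "\<exists>S1 \<in> nrt G (dic k c). \<exists>S2 \<in> nrt G (dic k d).
    nrt_loop G (dic k c) S1 \<cong> nrt_loop G (dic k d) S2"
proof -
  have nrt: "r ` {0..<k} \<in> nrt G (dic k c)" "inj_on r {0..<k}"
    if c: "subgroup (dic k c) G" for c
  proof -
    have ex1: "\<exists>!t. t \<in> {0..<k} \<and> r t \<in> dic k c #> g" if "g \<in> carrier G" for g
    proof -
      consider j where "g = r j" | j where "g = y j" using \<open>g \<in> carrier G\<close> carrier_eq by auto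
      then show ?thesis
        using ex1_residue[OF k(1)] by cases (simp_all only: mem_coset_dic[OF c k(2)])
    qed
    have "\<one> \<in> r ` {0..<k}" using k(1) by (simp add: one_eq)
    with nrt_family[OF c _ _ ex1] show "r ` {0..<k} \<in> nrt G (dic k c)" "inj_on r {0..<k}"
      by (simp_all add: image_subset_iff)
  qed
  have "nrt_loop G (dic k c) (r ` {0..<k}) \<cong> nrt_loop G (dic k d) (r ` {0..<k})"
    by (rule nrt_loop_iso[OF c d nrt[OF c] nrt[OF d]])
      (simp add: rr mem_coset_dic[OF c k(2)] mem_coset_dic[OF d k(2)])
  with nrt(1)[OF c] nrt(1)[OF d] show ?thesis by blast
qed

text \<open>The bijection of the transversals follows \<open>a \<mapsto> a\<^sup>2\<close>, \<open>b \<mapsto> a\<^bsup>c + 1\<^esup> b\<close>.\<close>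

lemma rot_dic_iso:
  assumes R: "subgroup (rot m) G" and D: "subgroup (dic (2 * m) c) G"
    and m: "m > 0" "2 * m dvd n"
  shows "\<exists>S1 \<in> nrt G (rot m). \<exists>S2 \<in> nrt G (dic (2 * m) c).
    nrt_loop G (rot m) S1 \<cong> nrt_loop G (dic (2 * m) c) S2"
proof -
  define J where "J = (UNIV :: bool set) \<times> {0..<m}"
  define p where "p = (\<lambda>(s, t). if s then y t else r t)"
  \<comment> \<open>The shift \<open>c + 1\<close> gives these exponents the parity opposite to
    \<open>c\<close>, so no \<open>a^i b\<close> in the image lies in
    \<open>dic (2 * m) c\<close>.\<close>
  define q where "q = (\<lambda>(s, t). if s then y (2 * t + c + 1) else r (2 * t))"
  have mn: "m dvd n" "m dvd 2 * n" using dvd_mult_right[OF m(2)] by simp_all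
  note R_coset = mem_coset_rot[OF R mn(2)] and D_coset = mem_coset_dic[OF D m(2)]
  have exR: "\<exists>!j. j \<in> J \<and> p j \<in> rot m #> g" if "g \<in> carrier G" for g
  proof -
    have "\<exists>s e. g = (if s then y e else r e)"
      using that by (auto simp: carrier_eq intro: exI[of _ True] exI[of _ False])
    then obtain s e where g: "g = (if s then y e else r e)" by blast
    have "(u, t) \<in> J \<and> p (u, t) \<in> rot m #> g \<longleftrightarrow> u = s \<and> t \<in> {0..<m} \<and> m dvd t - e" for u t
      by (auto simp: g J_def p_def R_coset)
    from ex1_Pair[OF ex1_residue[OF m(1)] this] show ?thesis .
  qed
  have exD: "\<exists>!j. j \<in> J \<and> q j \<in> dic (2 * m) c #> g" if "g \<in> carrier G" for g
  proof -
    \<comment> \<open>The elements \<open>r e\<close> and \<open>y (c - e)\<close> lie in the same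
      coset, so one parameter \<open>e\<close> describes both forms of \<open>g\<close>.\<close>
    obtain e where mem: "q (s, t) \<in> dic (2 * m) c #> g \<longleftrightarrow>
        2 * m dvd (if s then 2 * t + 1 + e else 2 * t - e)" for s t
    proof -
      have "y j = y (c - (c - j))" for j by simp
      then consider e where "g = r e" | e where "g = y (c - e)"
        using \<open>g \<in> carrier G\<close> unfolding carrier_eq by blast
      then show ?thesis
      proof cases
        case (1 e)
        show ?thesis
          by (rule that[of e], simp add: 1 q_def D_coset)
            (simp add: algebra_simps)
      next
        case (2 e)
        show ?thesis
          by (rule that[of e], simp add: 2 q_def D_coset)
            (simp add: algebra_simps)
      qed
    qed
    have "(u, t) \<in> J \<and> q (u, t) \<in> dic (2 * m) c #> g \<longleftrightarrow> u = odd e \<and> t \<in> {0..<m} \<and>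
        m dvd t - (if odd e then - ((e + 1) div 2) else e div 2)" for u t
      unfolding mem double_dvd_iff J_def by simp blast
    from ex1_Pair[OF ex1_residue[OF m(1)] this] show ?thesis .
  qed
  have "(False, 0) \<in> J" using m(1) by (simp add: J_def)
  moreover have "\<one> = p (False, 0)" "\<one> = q (False, 0)"
    by (simp_all add: one_eq p_def q_def)
  ultimately have "\<one> \<in> p ` J" "\<one> \<in> q ` J" by blast+
  moreover have "p ` J \<subseteq> carrier G" "q ` J \<subseteq> carrier G" by (auto simp: p_def q_def)
  ultimately have p: "p ` J \<in> nrt G (rot m)" "inj_on p J"
    and q: "q ` J \<in> nrt G (dic (2 * m) c)" "inj_on q J"
    using nrt_family[OF R _ _ exR] nrt_family[OF D _ _ exD] by simp_all
  have "nrt_loop G (rot m) (p ` J) \<cong> nrt_loop G (dic (2 * m) c) (q ` J)"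
  proof (rule nrt_loop_iso[OF R D p q])
    fix i j l assume pl: "p l \<in> rot m #> p i \<otimes> p j"
    obtain si ti sj tj sl tl where ijl: "i = (si, ti)" "j = (sj, tj)" "l = (sl, tl)"
      by (metis surj_pair)
    have drop_n: "k dvd u - (v + n) \<longleftrightarrow> k dvd u - v" if "k dvd n" for k u v
      using dvd_add_left_iff[OF that, of "u - (v + n)"] by (simp add: algebra_simps)
    have double: "2 * m dvd v" if "m dvd u" "v = 2 * u" for u v
      using that by simp
    show "q l \<in> dic (2 * m) c #> q i \<otimes> q j"
      using pl unfolding ijl
      by (cases si; cases sj; cases sl;
          simp add: p_def q_def rr ry yr yy R_coset D_coset drop_n[OF mn(1)] drop_n[OF m(2)];
          elim double; simp)
  qed
  with p(1) q(1) show ?thesis by blast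
qed

lemma t_group: "t_group G"
  unfolding t_group_def complete_graph_def
proof (intro conjI allI impI ballI)
  fix d H K
  assume "H \<in> fst (transiso_graph G d)" "K \<in> fst (transiso_graph G d)" and neq: "H \<noteq> K"
  then have H: "subgroup H G" "card H = d" and K: "subgroup K G" "card K = d"
    by (auto simp: transiso_graph_def)
  have edge: "{H, K} \<in> snd (transiso_graph G d)"
    if "\<exists>S1 \<in> nrt G H. \<exists>S2 \<in> nrt G K. nrt_loop G H S1 \<cong> nrt_loop G K S2"
      "subgroup H G" "card H = d" "subgroup K G" "card K = d" "H \<noteq> K" for H K
    using that unfolding transiso_graph_def by auto
  have mixed: "\<exists>S1 \<in> nrt G H. \<exists>S2 \<in> nrt G K. nrt_loop G H S1 \<cong> nrt_loop G K S2"
    if "subgroup H G" "subgroup K G" "card H = card K" and m: "m > 0" "m dvd 2 * n" "H = rot m"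
      and k: "k > 0" "k dvd n" "K = dic k c" for H K m k c
  proof -
    have "int (card H) * m * 2 = int (card H) * k"
      using card_rot[OF m(1,2)] card_dic[OF k(1), of c] k m that(3) by simp
    moreover have "card H \<noteq> 0" using card_rot[OF m(1,2)] n_pos m(3) by (intro notI) simp
    ultimately have "k = 2 * m" by simp
    with rot_dic_iso[of m c] that show ?thesis by simp
  qed
  from H(1) show "{H, K} \<in> snd (transiso_graph G d)"
  proof (cases rule: subgroup_cases)
    case H': (rot k)
    from K(1) show ?thesis
    proof (cases rule: subgroup_cases)
      case K': (rot l)
      have "d \<noteq> 0" using card_rot[OF H'(1,2)] n_pos H H' by (intro notI) simp
      then have "k = l" using card_rot[OF H'(1,2)] card_rot[OF K'(1,2)] H K H' K' by auto
      with neq H' K' show ?thesis by simp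
    next
      case K': (dic l c)
      show ?thesis by (rule edge[OF mixed]) (use H K H' K' neq in auto)
    qed
  next
    case H': (dic k c)
    from K(1) show ?thesis
    proof (cases rule: subgroup_cases)
      case K': (rot l)
      have "{K, H} \<in> snd (transiso_graph G d)"
        by (rule edge[OF mixed]) (use H K H' K' neq in auto)
      then show ?thesis by (simp add: insert_commute)
    next
      case K': (dic l e)
      have "int d * k = 4 * n" "int d * l = 4 * n"
        using card_dic[of k c] card_dic[of l e] H K H' K' by auto
      then have "int d * k = int d * l" "d \<noteq> 0" using n_pos by (simp, intro notI, simp)
      then have "k = l" by simp
      then show ?thesis
        by (intro edge) (use H K H' K' neq dic_dic_iso[of k c e] in auto)
    qed
  qed
qed (simp_all add: is_group finite_carrier)

end


section \<open>The normal form in the presented dicyclic group\<close>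

text \<open>The state \<open>(i, s)\<close> stands for \<open>a\<^sup>i\<close> or, if \<open>s\<close> holds, for \<open>a\<^sup>i b\<close>; letters act by left
  multiplication.\<close>

fun letter_act :: "int \<Rightarrow> dicyclic_gen letter \<Rightarrow> int \<times> bool \<Rightarrow> int \<times> bool" where
  "letter_act n (Gen A) (i, s) = ((i + 1) mod (2 * n), s)"
| "letter_act n (Gen_inv A) (i, s) = ((i - 1) mod (2 * n), s)"
| "letter_act n (Gen B) (i, s) = ((if s then n - i else - i) mod (2 * n), \<not> s)"
| "letter_act n (Gen_inv B) (i, s) = ((if s then - i else n - i) mod (2 * n), \<not> s)"

lemma foldr_letter_act_range:
  "n > 0 \<Longrightarrow> p \<in> {0..<2 * n} \<times> UNIV \<Longrightarrow> foldr (letter_act n) w p \<in> {0..<2 * n} \<times> UNIV"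
proof (induction w)
  case (Cons l w)
  then show ?case
    by (cases "foldr (letter_act n) w p"; cases l; cases "case l of Gen x \<Rightarrow> x | Gen_inv x \<Rightarrow> x") auto
qed simp

lemma foldr_letter_act_replicate:
  assumes "i \<in> {0..<2 * n}"
  shows "foldr (letter_act n) (replicate m (Gen A)) (i, s) = ((i + int m) mod (2 * n), s)"
  using assms by (induction m) (auto simp: mod_simps ac_simps)

lemma word_eq_letter_act:
  assumes "n > 0" "word_eq (dicyclic_relators n) u v" "p \<in> {0..<2 * int n} \<times> UNIV"
  shows "foldr (letter_act (int n)) u p = foldr (letter_act (int n)) v p"
  using assms(2,3)
proof (induction arbitrary: p rule: word_eq.induct)
  case (cancel_right u x v)
  then have "foldr (letter_act (int n)) v p \<in> {0..<2 * int n} \<times> UNIV"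
    using assms(1) by (intro foldr_letter_act_range) auto
  then show ?case
    by (cases "foldr (letter_act (int n)) v p"; cases x) (auto simp: mod_simps)
next
  case (cancel_left u x v)
  then have "foldr (letter_act (int n)) v p \<in> {0..<2 * int n} \<times> UNIV"
    using assms(1) by (intro foldr_letter_act_range) auto
  then show ?case
    by (cases "foldr (letter_act (int n)) v p"; cases x) (auto simp: mod_simps)
next
  case (relator w u v)
  then have "foldr (letter_act (int n)) v p \<in> {0..<2 * int n} \<times> UNIV"
    using assms(1) by (intro foldr_letter_act_range) auto
  with relator(1) assms(1) show ?case
    by (cases "foldr (letter_act (int n)) v p")
      (auto simp: dicyclic_relators_def mod_simps diff_add_eq foldr_letter_act_replicate
        simp del: foldr_replicate)
next
  case (sym v w)
  from sym.IH[OF sym.prems] show ?case by (rule HOL.sym)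
next
  case (trans u v w)
  from trans.IH(1)[OF trans.prems] trans.IH(2)[OF trans.prems] show ?case by (rule HOL.trans)
qed (rule HOL.refl)

lemma (in group) int_pow_inverted:
  assumes a: "a \<in> carrier G" and b: "b \<in> carrier G" and ba: "b \<otimes> a = inv a \<otimes> b"
  shows "b \<otimes> a [^] (i :: int) = a [^] (- i) \<otimes> b"
proof -
  have nat: "b \<otimes> a [^] (k :: nat) = inv (a [^] k) \<otimes> b" for k
  proof (induction k)
    case (Suc k)
    have "b \<otimes> a [^] Suc k = (b \<otimes> a [^] k) \<otimes> a" using a b by (simp add: m_assoc)
    also have "\<dots> = inv (a [^] k) \<otimes> (b \<otimes> a)" using a b by (simp add: Suc.IH m_assoc)
    also have "\<dots> = inv (a \<otimes> a [^] k) \<otimes> b" using a b by (simp add: ba m_assoc inv_mult_group)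
    finally show ?case using a by (simp add: nat_pow_Suc2[symmetric] del: nat_pow_Suc)
  qed (use b in simp)
  show ?thesis
  proof (cases i rule: int_cases2)
    case (nonneg k)
    then show ?thesis using nat[of k] a by (simp add: int_pow_neg int_pow_int)
  next
    case (nonpos k)
    have "a [^] k \<otimes> (b \<otimes> a [^] k) = b" using a b by (simp add: nat m_assoc[symmetric])
    then have "a [^] k \<otimes> b \<otimes> a [^] k \<otimes> inv (a [^] k) = b \<otimes> inv (a [^] k)"
      using a b by (simp add: m_assoc)
    then have "b \<otimes> inv (a [^] k) = a [^] k \<otimes> b" using a b by (simp add: m_assoc)
    then show ?thesis using a by (simp add: nonpos int_pow_neg int_pow_int)
  qed
qed

lemma dicyclic_dicyclic_group:
  fixes n :: nat
  assumes "n \<ge> 1"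
  obtains r y where "dicyclic (dicyclic_group n) (int n) r y"
proof -
  let ?R = "dicyclic_relators n"
  let ?G = "dicyclic_group n"
  define a b where "a = word_class ?R [Gen A]" and "b = word_class ?R [Gen B]"
  interpret group ?G unfolding dicyclic_group_def by (rule group_presented_group)
  have carrier: "carrier ?G = range (word_class ?R)"
    and one: "\<one>\<^bsub>?G\<^esub> = word_class ?R []"
    by (simp_all add: dicyclic_group_def presented_group_def)
  have mult: "word_class ?R u \<otimes>\<^bsub>?G\<^esub> word_class ?R v = word_class ?R (u @ v)" for u v
    by (simp add: dicyclic_group_def presented_group_mult)
  have closed [simp]: "word_class ?R w \<in> carrier ?G" for w by (simp add: carrier)
  have [simp]: "a \<in> carrier ?G" "b \<in> carrier ?G" by (simp_all add: a_def b_def)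
  have relator: "word_class ?R w = \<one>\<^bsub>?G\<^esub>" if "w \<in> ?R" for w
    using word_eq.relator[OF that, of "[]" "[]"] by (simp add: one word_class_eq_iff)
  have a_pow: "a [^]\<^bsub>?G\<^esub> k = word_class ?R (replicate k (Gen A))" for k :: nat
    by (induction k) (simp_all add: one a_def mult replicate_append_same)
  have inv_gen: "inv\<^bsub>?G\<^esub> (word_class ?R [Gen x]) = word_class ?R [Gen_inv x]" for x
    using word_eq.cancel_left[of ?R "[]" x "[]"]
    by (intro inv_equality) (simp_all add: mult one word_class_eq_iff)
  have a2n: "a [^]\<^bsub>?G\<^esub> (2 * n) = \<one>\<^bsub>?G\<^esub>"
    unfolding a_pow by (rule relator) (simp add: dicyclic_relators_def)
  have anbb: "a [^]\<^bsub>?G\<^esub> n \<otimes>\<^bsub>?G\<^esub> (b \<otimes>\<^bsub>?G\<^esub> b) = \<one>\<^bsub>?G\<^esub>"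
    unfolding a_pow unfolding b_def mult by (rule relator) (simp add: dicyclic_relators_def)
  have abab: "a \<otimes>\<^bsub>?G\<^esub> b \<otimes>\<^bsub>?G\<^esub> a \<otimes>\<^bsub>?G\<^esub> inv\<^bsub>?G\<^esub> b = \<one>\<^bsub>?G\<^esub>"
    unfolding a_def b_def mult inv_gen by (rule relator) (simp add: dicyclic_relators_def)
  have ba: "b \<otimes>\<^bsub>?G\<^esub> a = inv\<^bsub>?G\<^esub> a \<otimes>\<^bsub>?G\<^esub> b"
  proof -
    have "a \<otimes>\<^bsub>?G\<^esub> (b \<otimes>\<^bsub>?G\<^esub> a) = b" 
      using abab by (metis \<open>a \<in> carrier ?G\<close> \<open>b \<in> carrier ?G\<close> inv_closed inv_equality inv_inv m_assoc m_closed)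
    then show ?thesis by (metis \<open>a \<in> carrier ?G\<close> \<open>b \<in> carrier ?G\<close> inv_solve_left m_closed)
  qed
  define r where "r i = a [^]\<^bsub>?G\<^esub> i" for i :: int
  define y where "y i = r i \<otimes>\<^bsub>?G\<^esub> b" for i
  have [simp]: "r i \<in> carrier ?G" "y i \<in> carrier ?G" for i by (simp_all add: r_def y_def)
  have rr: "r i \<otimes>\<^bsub>?G\<^esub> r j = r (i + j)" for i j by (simp add: r_def int_pow_mult)
  have ry: "r i \<otimes>\<^bsub>?G\<^esub> y j = y (i + j)" for i j
    by (simp add: y_def m_assoc[symmetric] rr)
  have br: "b \<otimes>\<^bsub>?G\<^esub> r i = y (- i)" for i
    by (simp add: r_def y_def int_pow_inverted ba)
  have yr: "y i \<otimes>\<^bsub>?G\<^esub> r j = y (i - j)" for i j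
    by (simp add: y_def m_assoc br) (simp add: y_def m_assoc[symmetric] rr)
  have r0: "r 0 = \<one>\<^bsub>?G\<^esub>" by (simp add: r_def)
  have r2n: "r (2 * int n) = \<one>\<^bsub>?G\<^esub>"
    using a2n by (simp add: r_def flip: int_pow_int)
  have bb: "b \<otimes>\<^bsub>?G\<^esub> b = r (int n)"
  proof -
    have "r (int n) \<otimes>\<^bsub>?G\<^esub> (b \<otimes>\<^bsub>?G\<^esub> b) = r (int n) \<otimes>\<^bsub>?G\<^esub> r (int n)"
      using anbb r2n by (simp add: rr) (simp add: r_def int_pow_int)
    then show ?thesis by simp
  qed
  have yy: "y i \<otimes>\<^bsub>?G\<^esub> y j = r (i - j + int n)" for i j
  proof -
    have "y i \<otimes>\<^bsub>?G\<^esub> y j = y i \<otimes>\<^bsub>?G\<^esub> r j \<otimes>\<^bsub>?G\<^esub> b" by (simp add: y_def m_assoc)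
    also have "\<dots> = r (i - j) \<otimes>\<^bsub>?G\<^esub> (b \<otimes>\<^bsub>?G\<^esub> b)" by (simp add: yr) (simp add: y_def m_assoc)
    finally show ?thesis by (simp add: bb rr)
  qed
  have "r (2 * int n * q) = \<one>\<^bsub>?G\<^esub>" for q
    using r2n by (simp add: r_def int_pow_pow[symmetric])
  then have r_mod: "r (i mod (2 * int n)) = r i" for i
    using rr[of "2 * int n * (i div (2 * int n))" "i mod (2 * int n)"] by simp
  have r_word: "r i = word_class ?R (replicate (nat (i mod (2 * int n))) (Gen A))" for i
    using r_mod[of i] assms unfolding a_pow[symmetric] by (simp add: r_def pow_nat)
  have y_word: "y i = word_class ?R (replicate (nat (i mod (2 * int n))) (Gen A) @ [Gen B])" for i
    by (simp add: y_def r_word b_def mult)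
  define ev where "ev X = foldr (letter_act (int n)) (SOME w. word_class ?R w = X) (0, False)" for X
  have ev: "ev (word_class ?R w) = foldr (letter_act (int n)) w (0, False)" for w
    unfolding ev_def
    by (rule word_eq_letter_act)
      (use assms someI[of "\<lambda>v. word_class ?R v = word_class ?R w" w] in \<open>auto simp: word_class_eq_iff\<close>)
  have ev_r: "ev (r i) = (i mod (2 * int n), False)" and ev_y: "ev (y i) = (i mod (2 * int n), True)" for i
    using assms
    by (simp_all add: r_word y_word ev foldr_letter_act_replicate del: foldr_replicate)
  have "word_class ?R w \<in> range r \<union> range y" for w
  proof (induction w)
    case Nil
    show ?case using r0 by (auto simp: one)
  next
    case (Cons l w)
    have "inv\<^bsub>?G\<^esub> b = y (int n)"
      by (rule inv_equality) (simp_all add: y_def m_assoc bb rr r2n)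
    then have "word_class ?R [Gen_inv B] = y (int n)" by (simp add: b_def inv_gen)
    moreover have "inv\<^bsub>?G\<^esub> a = r (- 1)" by (simp add: r_def int_pow_neg)
    then have "word_class ?R [Gen_inv A] = r (- 1)" by (simp add: a_def inv_gen)
    moreover have "word_class ?R [Gen A] = r 1" "word_class ?R [Gen B] = y 0"
      by (simp_all add: r_def y_def flip: a_def b_def)
    ultimately have "word_class ?R [l] \<in> range r \<union> range y"
      by (cases l; cases "case l of Gen x \<Rightarrow> x | Gen_inv x \<Rightarrow> x") simp_all
    moreover have "word_class ?R (l # w) = word_class ?R [l] \<otimes>\<^bsub>?G\<^esub> word_class ?R w"
      by (simp add: mult)
    ultimately show ?case using Cons by (auto simp: rr ry yr yy)
  qed
  then have "carrier ?G \<subseteq> range r \<union> range y" by (auto simp: carrier)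
  moreover have "range r \<union> range y \<subseteq> carrier ?G" by (simp add: image_subset_iff)
  ultimately have carrier_eq: "carrier ?G = range r \<union> range y" by (rule equalityI)
  have "dicyclic ?G (int n) r y"
  proof
    show "r i = r j \<longleftrightarrow> 2 * int n dvd i - j" "y i = y j \<longleftrightarrow> 2 * int n dvd i - j" for i j
      unfolding mod_eq_dvd_iff[symmetric]
      by (metis ev_r r_word fst_conv, metis ev_y y_word fst_conv)
    show "r i \<noteq> y j" for i j using ev_r[of i] ev_y[of j] by (intro notI) simp
  qed (use assms in \<open>simp_all add: carrier_eq rr ry yr yy\<close>)
  then show thesis by (rule that)
qed

theorem proposition3p2:
  fixes n :: nat
  assumes "n \<ge> 1"
  shows "t_group (dicyclic_group n)"
proof -
  obtain r y where "dicyclic (dicyclic_group n) (int n) r y"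
    using assms by (rule dicyclic_dicyclic_group)
  then show ?thesis by (rule dicyclic.t_group)
qed

end
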